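(* Let $P$ and $Q$ be polynomial expressions in the variables $\lambda_1,\dots,\lambda_m$. Assume that the identity $P=Q$ holds in all commutative rings. If the identity $P=Q$ holds in all commutative tropical algebras, then the identity $P=Q$ holds in all commutative ELT rings, i.e. for every commutative ELT ring $\mathcal R$ and all $r_1,\dots,r_m\in\overline{\mathcal R}$ one has $P(r_1,\dots,r_m)=Q(r_1,\dots,r_m)$.
   Context: Polynomial expressions: a positive polynomial expression in $\lambda_1,\dots,\lambda_m$ is a formal expression built from the symbols $0,1,\lambda_1,\dots,\lambda_m$ by finitely many formal additions and multiplications. A polynomial expression is a formal expression $P=P^+-P^-$ with $P^+,P^-$ positive polynomial expressions. A negation map on a semiring $R$ is a map $(-):R\to R$ with $(-)(a+b)=(-)a+(-)b$, $(-)0_R=0_R$, $(-)(ab)=a((-)b)=((-)a)b$ and $(-)((-)a)=a$. A polynomial expression is evaluated at $r_1,\dots,r_m\in R$ by $P(r)=P^+(r)+\big((-)P^-(r)\big)$, where the symbols $0,1$ are interpreted as the zero and unit of $R$. The identity $P=Q$ holds in $R$ if $P(r_1,\dots,r_m)=Q(r_1,\dots,r_m)$ for all $r_1,\dots,r_m\in R$. Commutative rings are taken with the negation map $(-)a=-a$. Commutative tropical algebras: for a totally ordered abelian group $G$, the max-plus algebra $\overline{G_{\max}}=G\cup\{-\infty\}$ with $a\oplus b=\max\{a,b\}$ and $a\odot b$ the group operation of $G$, where $-\infty$ is smaller than every element of $G$ and is absorbing for $\odot$; it is taken with the trivial negation map $(-)a=a$. Commutative ELT rings: let $F$ be a totally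 ordered abelian group (written additively) and $L$ a commutative ring with unit. The commutative ELT ring $\mathcal R=\mathscr R(L,F)$ is the set of symbols ${}^{[\ell]}a$ ($a\in F$, $\ell\in L$) with multiplication ${}^{[\ell_1]}a_1\cdot{}^{[\ell_2]}a_2={}^{[\ell_1\ell_2]}(a_1+a_2)$ and addition ${}^{[\ell_1]}a_1+{}^{[\ell_2]}a_2$ equal to ${}^{[\ell_1]}a_1$ if $a_1>a_2$, to ${}^{[\ell_2]}a_2$ if $a_1<a_2$, and to ${}^{[\ell_1+\ell_2]}a_1$ if $a_1=a_2$. Set $\overline{\mathcal R}=\mathcal R\cup\{-\infty\}$, where $-\infty+\alpha=\alpha+(-\infty)=\alpha$ and $-\infty\cdot\alpha=\alpha\cdot(-\infty)=-\infty$; this is a commutative semiring with zero $-\infty$ and unit ${}^{[1]}0$. Its negation map is $(-)\alpha={}^{[-1]}0\cdot\alpha$, i.e. $(-)\,{}^{[\ell]}a={}^{[-\ell]}a$. *)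

theory Defs
  imports "HOL-Algebra.Ring" "HOL-Library.Infinite_Typeclass"
begin

section \<open>Polynomial expressions\<close>

text \<open>\<open>PVar i\<close> is the symbol \<open>\<lambda>\<^sub>i\<close>, and \<open>PMinus P Q\<close> is the formal difference \<open>P - Q\<close>.\<close>

datatype pos_expr = PZero | POne | PVar nat | PAdd pos_expr pos_expr | PMult pos_expr pos_expr

datatype poly_expr = PMinus (pos_part: pos_expr) (neg_part: pos_expr)

primrec pos_vars :: "pos_expr \<Rightarrow> nat set" where
  "pos_vars PZero = {}"
| "pos_vars POne = {}"
| "pos_vars (PVar i) = {i}"
| "pos_vars (PAdd p q) = pos_vars p \<union> pos_vars q"
| "pos_vars (PMult p q) = pos_vars p \<union> pos_vars q"

definition poly_vars :: "poly_expr \<Rightarrow> nat set" where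
  "poly_vars P = pos_vars (pos_part P) \<union> pos_vars (neg_part P)"


section \<open>Semirings with a negation map, evaluation, identities\<close>

locale semiring_with_negation = semiring R for R (structure) +
  fixes neg :: "'a \<Rightarrow> 'a"
  assumes neg_closed: "a \<in> carrier R \<Longrightarrow> neg a \<in> carrier R"
    and neg_add: "\<lbrakk>a \<in> carrier R; b \<in> carrier R\<rbrakk> \<Longrightarrow> neg (a \<oplus> b) = neg a \<oplus> neg b"
    and neg_zero: "neg \<zero> = \<zero>"
    and neg_mult_right: "\<lbrakk>a \<in> carrier R; b \<in> carrier R\<rbrakk> \<Longrightarrow> neg (a \<otimes> b) = a \<otimes> neg b"
    and neg_mult_left: "\<lbrakk>a \<in> carrier R; b \<in> carrier R\<rbrakk> \<Longrightarrow> neg (a \<otimes> b) = neg a \<otimes> b"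
    and neg_neg: "a \<in> carrier R \<Longrightarrow> neg (neg a) = a"

primrec eval_pos :: "('a, 'b) ring_scheme \<Rightarrow> (nat \<Rightarrow> 'a) \<Rightarrow> pos_expr \<Rightarrow> 'a" where
  "eval_pos R r PZero = \<zero>\<^bsub>R\<^esub>"
| "eval_pos R r POne = \<one>\<^bsub>R\<^esub>"
| "eval_pos R r (PVar i) = r i"
| "eval_pos R r (PAdd p q) = eval_pos R r p \<oplus>\<^bsub>R\<^esub> eval_pos R r q"
| "eval_pos R r (PMult p q) = eval_pos R r p \<otimes>\<^bsub>R\<^esub> eval_pos R r q"

definition eval_poly ::
  "('a, 'b) ring_scheme \<Rightarrow> ('a \<Rightarrow> 'a) \<Rightarrow> (nat \<Rightarrow> 'a) \<Rightarrow> poly_expr \<Rightarrow> 'a" where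
  "eval_poly R neg r P = eval_pos R r (pos_part P) \<oplus>\<^bsub>R\<^esub> neg (eval_pos R r (neg_part P))"

definition identity_holds ::
  "('a, 'b) ring_scheme \<Rightarrow> ('a \<Rightarrow> 'a) \<Rightarrow> nat \<Rightarrow> poly_expr \<Rightarrow> poly_expr \<Rightarrow> bool" where
  "identity_holds R neg m P Q \<longleftrightarrow>
     (\<forall>r. (\<forall>i\<in>{1..m}. r i \<in> carrier R) \<longrightarrow> eval_poly R neg r P = eval_poly R neg r Q)"

lemma (in cring) cring_semiring_with_negation: "semiring_with_negation R (\<lambda>a. \<ominus> a)"
  by unfold_locales (auto simp: minus_add l_minus r_minus)


section \<open>Totally ordered abelian groups\<close>

text \<open>
  The group operation is the \<open>\<otimes>\<close> of a \<open>HOL-Algebra\<close> group (so the neutral element, written \<open>0\<close>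
  in additive notation, is \<open>\<one>\<close>), and \<open>(a, b) \<in> leq\<close> means \<open>a \<le> b\<close>.
\<close>

locale tot_ord_ab_group = comm_group G for G (structure) +
  fixes leq :: "'a rel"
  assumes linear_order: "linear_order_on (carrier G) leq"
    and mult_mono: "\<lbrakk>(a, b) \<in> leq; c \<in> carrier G\<rbrakk> \<Longrightarrow> (a \<otimes> c, b \<otimes> c) \<in> leq"


section \<open>Max-plus algebras and ELT rings\<close>

text \<open>
  Pitfall: "all commutative rings" and "all totally ordered abelian groups" can only be quantified
  over those with carrier inside a given type. When such a quantification is used as a hypothesis,
  that type must be infinite: on a finite type the only totally ordered abelian groups are trivial,
  and only rings of bounded finite size occur. Hence the class \<open>infinite\<close>.
\<close>

text \<open>
  Adjoining \<open>-\<infinity>\<close>, represented by \<open>None\<close>, to a set \<open>A\<close> with multiplication \<open>mul\<close>, unit \<open>e\<close> and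
  addition \<open>pls\<close>: it is neutral for addition and absorbing for multiplication.
\<close>

definition adjoin_minus_inf ::
  "'a set \<Rightarrow> ('a \<Rightarrow> 'a \<Rightarrow> 'a) \<Rightarrow> 'a \<Rightarrow> ('a \<Rightarrow> 'a \<Rightarrow> 'a) \<Rightarrow> 'a option ring" where
  "adjoin_minus_inf A mul e pls =
    \<lparr> carrier = insert None (Some ` A),
      monoid.mult = (\<lambda>x y. case (x, y) of (Some a, Some b) \<Rightarrow> Some (mul a b) | _ \<Rightarrow> None),
      one = Some e,
      zero = None,
      add = (\<lambda>x y. case (x, y) of (Some a, Some b) \<Rightarrow> Some (pls a b)
                                | (None, _) \<Rightarrow> y
                                | (_, None) \<Rightarrow> x) \<rparr>"

definition max_plus :: "('a, 'b) monoid_scheme \<Rightarrow> 'a rel \<Rightarrow> 'a option ring" where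
  "max_plus G leq =
     adjoin_minus_inf (carrier G) (\<lambda>a b. a \<otimes>\<^bsub>G\<^esub> b) \<one>\<^bsub>G\<^esub> (\<lambda>a b. if (a, b) \<in> leq then b else a)"

text \<open>The pair \<open>(l, a)\<close> represents the ELT element with layer \<open>l\<close> and tangible value \<open>a\<close>.\<close>

definition elt_mult ::
  "('l, 'c) ring_scheme \<Rightarrow> ('f, 'd) monoid_scheme \<Rightarrow> 'l \<times> 'f \<Rightarrow> 'l \<times> 'f \<Rightarrow> 'l \<times> 'f" where
  "elt_mult L F = (\<lambda>(l1, a1) (l2, a2). (l1 \<otimes>\<^bsub>L\<^esub> l2, a1 \<otimes>\<^bsub>F\<^esub> a2))"

definition elt_add ::
  "('l, 'c) ring_scheme \<Rightarrow> 'f rel \<Rightarrow> 'l \<times> 'f \<Rightarrow> 'l \<times> 'f \<Rightarrow> 'l \<times> 'f" where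
  "elt_add L leq = (\<lambda>(l1, a1) (l2, a2).
     if a1 = a2 then (l1 \<oplus>\<^bsub>L\<^esub> l2, a1) else if (a1, a2) \<in> leq then (l2, a2) else (l1, a1))"

definition elt_ring ::
  "('l, 'c) ring_scheme \<Rightarrow> ('f, 'd) monoid_scheme \<Rightarrow> 'f rel \<Rightarrow> ('l \<times> 'f) option ring" where
  "elt_ring L F leq =
     adjoin_minus_inf (carrier L \<times> carrier F) (elt_mult L F) (\<one>\<^bsub>L\<^esub>, \<one>\<^bsub>F\<^esub>) (elt_add L leq)"

definition elt_neg ::
  "('l, 'c) ring_scheme \<Rightarrow> ('f, 'd) monoid_scheme \<Rightarrow> 'f rel
    \<Rightarrow> ('l \<times> 'f) option \<Rightarrow> ('l \<times> 'f) option" where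
  "elt_neg L F leq \<alpha> = Some (\<ominus>\<^bsub>L\<^esub> \<one>\<^bsub>L\<^esub>, \<one>\<^bsub>F\<^esub>) \<otimes>\<^bsub>elt_ring L F leq\<^esub> \<alpha>"


section \<open>The structures are commutative semirings with negation map\<close>

lemma adjoin_simps:
  "carrier (adjoin_minus_inf A mul e pls) = insert None (Some ` A)"
  "one (adjoin_minus_inf A mul e pls) = Some e"
  "zero (adjoin_minus_inf A mul e pls) = None"
  "monoid.mult (adjoin_minus_inf A mul e pls) (Some a) (Some b) = Some (mul a b)"
  "monoid.mult (adjoin_minus_inf A mul e pls) None y = None"
  "monoid.mult (adjoin_minus_inf A mul e pls) y None = None"
  "add (adjoin_minus_inf A mul e pls) (Some a) (Some b) = Some (pls a b)"
  "add (adjoin_minus_inf A mul e pls) None y = y"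
  "add (adjoin_minus_inf A mul e pls) y None = y"
  by (auto simp: adjoin_minus_inf_def split: option.splits)

lemma adjoin_minus_inf_semiring:
  fixes A :: "'a set"
  assumes "\<And>a b. a \<in> A \<Longrightarrow> b \<in> A \<Longrightarrow> mul a b \<in> A"
    and "\<And>a b. a \<in> A \<Longrightarrow> b \<in> A \<Longrightarrow> pls a b \<in> A"
    and "e \<in> A"
    and "\<And>a. a \<in> A \<Longrightarrow> mul e a = a"
    and "\<And>a b. a \<in> A \<Longrightarrow> b \<in> A \<Longrightarrow> mul a b = mul b a"
    and "\<And>a b c. a \<in> A \<Longrightarrow> b \<in> A \<Longrightarrow> c \<in> A \<Longrightarrow> mul (mul a b) c = mul a (mul b c)"
    and "\<And>a b. a \<in> A \<Longrightarrow> b \<in> A \<Longrightarrow> pls a b = pls b a"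
    and "\<And>a b c. a \<in> A \<Longrightarrow> b \<in> A \<Longrightarrow> c \<in> A \<Longrightarrow> pls (pls a b) c = pls a (pls b c)"
    and "\<And>a b c. a \<in> A \<Longrightarrow> b \<in> A \<Longrightarrow> c \<in> A \<Longrightarrow> mul (pls a b) c = pls (mul a c) (mul b c)"
  shows "semiring (adjoin_minus_inf A mul e pls)" "comm_monoid (adjoin_minus_inf A mul e pls)"
proof -
  let ?R = "adjoin_minus_inf A mul e pls"
  have l: "mul c (pls a b) = pls (mul c a) (mul c b)" if "a \<in> A" "b \<in> A" "c \<in> A" for a b c
    using that assms(2,5,9) by metis
  have r: "mul a e = a" if "a \<in> A" for a
    using that assms(3,4,5) by metis
  show cm: "comm_monoid ?R"
    by unfold_locales (use assms in \<open>auto simp: adjoin_simps Units_def r\<close>)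
  have am: "abelian_monoid ?R"
    by (rule abelian_monoidI) (use assms in \<open>auto simp: adjoin_simps\<close>)
  show "semiring ?R"
    by (intro semiring.intro semiring_axioms.intro am comm_monoid.axioms(1)[OF cm])
      (use assms l in \<open>auto simp: adjoin_simps\<close>)
qed

context tot_ord_ab_group begin

lemma leq_linear:
  "a \<in> carrier G \<Longrightarrow> (a, a) \<in> leq"
  "(a, b) \<in> leq \<Longrightarrow> (b, c) \<in> leq \<Longrightarrow> (a, c) \<in> leq"
  "(a, b) \<in> leq \<Longrightarrow> (b, a) \<in> leq \<Longrightarrow> a = b"
  "a \<in> carrier G \<Longrightarrow> b \<in> carrier G \<Longrightarrow> (a, b) \<notin> leq \<Longrightarrow> (b, a) \<in> leq"
proof -
  note lo = linear_order[unfolded order_on_defs]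
  show refl: "a \<in> carrier G \<Longrightarrow> (a, a) \<in> leq" for a
    using lo by (auto simp: refl_on_def)
  show "(a, b) \<in> leq \<Longrightarrow> (b, c) \<in> leq \<Longrightarrow> (a, c) \<in> leq"
    using lo by (blast dest: transD)
  show "(a, b) \<in> leq \<Longrightarrow> (b, a) \<in> leq \<Longrightarrow> a = b"
    using lo by (blast dest: antisymD)
  show "a \<in> carrier G \<Longrightarrow> b \<in> carrier G \<Longrightarrow> (a, b) \<notin> leq \<Longrightarrow> (b, a) \<in> leq"
    using lo refl by (cases "a = b") (auto simp: total_on_def)
qed

lemma leq_mult_cancel:
  assumes "a \<in> carrier G" "b \<in> carrier G" "c \<in> carrier G"
  shows "(a \<otimes> c, b \<otimes> c) \<in> leq \<longleftrightarrow> (a, b) \<in> leq"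
proof
  assume 1: "(a \<otimes> c, b \<otimes> c) \<in> leq"
  show "(a, b) \<in> leq"
  proof (rule ccontr)
    assume n: "(a, b) \<notin> leq"
    then have "(b \<otimes> c, a \<otimes> c) \<in> leq" using assms leq_linear(4) mult_mono by blast
    then have "a \<otimes> c = b \<otimes> c" using 1 leq_linear(3) by blast
    then have "a = b" using assms by simp
    then show False using n assms leq_linear(1) by blast
  qed
qed (use assms mult_mono in blast)

lemma max_plus_semiring_with_negation:
  "semiring_with_negation (max_plus G leq) (\<lambda>a. a)" "comm_monoid (max_plus G leq)"
proof -
  have assoc: "(if (if (a, b) \<in> leq then b else a, c) \<in> leq then c else if (a, b) \<in> leq then b else a) =
     (if (a, if (b, c) \<in> leq then c else b) \<in> leq then if (b, c) \<in> leq then c else b else a)"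
    if "a \<in> carrier G" "b \<in> carrier G" "c \<in> carrier G" for a b c
    using that leq_linear(2)[of a b c] leq_linear(2)[of b a c] leq_linear(4)[of a b] leq_linear(4)[of b c]
      leq_linear(2)[of c b a] leq_linear(3)[of a c] by (auto split: if_splits)
  have comm: "(if (a, b) \<in> leq then b else a) = (if (b, a) \<in> leq then a else b)"
    if "a \<in> carrier G" "b \<in> carrier G" for a b
    using that leq_linear(3)[of a b] leq_linear(4)[of a b] by auto
  have "semiring (max_plus G leq) \<and> comm_monoid (max_plus G leq)"
    unfolding max_plus_def
    by (intro conjI adjoin_minus_inf_semiring assoc comm)
      (auto simp: m_assoc leq_mult_cancel intro: m_comm)
  then show "semiring_with_negation (max_plus G leq) (\<lambda>a. a)" "comm_monoid (max_plus G leq)"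
    by (auto simp: semiring_with_negation_def semiring_with_negation_axioms_def)
qed

lemma elt_add_assoc:
  assumes "cring L" and "x \<in> carrier L \<times> carrier G" "y \<in> carrier L \<times> carrier G"
    "z \<in> carrier L \<times> carrier G"
  shows "elt_add L leq (elt_add L leq x y) z = elt_add L leq x (elt_add L leq y z)"
proof -
  interpret L: cring L by fact
  obtain l a k b j c where [simp]: "x = (l, a)" "y = (k, b)" "z = (j, c)" by (cases x, cases y, cases z)
  show ?thesis
    using assms(2-4) leq_linear(2)[of a b c] leq_linear(2)[of c b a] leq_linear(3)[of a b]
      leq_linear(3)[of b c] leq_linear(3)[of a c]
      leq_linear(4)[of a b] leq_linear(4)[of b c] leq_linear(4)[of a c]
    by (auto simp: elt_add_def L.a_assoc)
qed

lemma elt_ring_semiring: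
  assumes "cring L"
  shows "semiring (elt_ring L G leq)" "comm_monoid (elt_ring L G leq)"
proof -
  interpret L: cring L by fact
  have comm: "elt_add L leq x y = elt_add L leq y x"
    if "x \<in> carrier L \<times> carrier G" "y \<in> carrier L \<times> carrier G" for x y
    using that leq_linear(3)[of "snd x" "snd y"] leq_linear(4)[of "snd x" "snd y"]
    by (auto simp: elt_add_def L.a_comm split: prod.splits)
  have distr: "elt_mult L G (elt_add L leq x y) z = elt_add L leq (elt_mult L G x z) (elt_mult L G y z)"
    if "x \<in> carrier L \<times> carrier G" "y \<in> carrier L \<times> carrier G" "z \<in> carrier L \<times> carrier G" for x y z
    using that by (auto simp: elt_add_def elt_mult_def L.l_distr leq_mult_cancel)
  have "semiring (elt_ring L G leq) \<and> comm_monoid (elt_ring L G leq)"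
    unfolding elt_ring_def
    by (intro conjI adjoin_minus_inf_semiring elt_add_assoc[OF assms] comm distr)
      (auto simp: elt_mult_def elt_add_def m_assoc L.m_assoc intro: m_comm L.m_comm)
  then show "semiring (elt_ring L G leq)" "comm_monoid (elt_ring L G leq)" by auto
qed

lemma elt_neg_simps:
  assumes "cring L" "l \<in> carrier L" "a \<in> carrier G"
  shows "elt_neg L G leq (Some (l, a)) = Some (\<ominus>\<^bsub>L\<^esub> l, a)" "elt_neg L G leq None = None"
proof -
  interpret L: cring L by fact
  show "elt_neg L G leq (Some (l, a)) = Some (\<ominus>\<^bsub>L\<^esub> l, a)" "elt_neg L G leq None = None"
    using assms by (simp_all add: elt_neg_def elt_ring_def adjoin_simps elt_mult_def L.l_minus)
qed

lemma elt_ring_semiring_with_negation: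
  assumes "cring L"
  shows "semiring_with_negation (elt_ring L G leq) (elt_neg L G leq)"
proof -
  interpret L: cring L by fact
  let ?R = "elt_ring L G leq" and ?e = "Some (\<ominus>\<^bsub>L\<^esub> \<one>\<^bsub>L\<^esub>, \<one>)"
  interpret S: semiring ?R using elt_ring_semiring(1)[OF assms] .
  interpret M: comm_monoid ?R using elt_ring_semiring(2)[OF assms] .
  have e: "?e \<in> carrier ?R" by (simp add: elt_ring_def adjoin_simps)
  have ee: "?e \<otimes>\<^bsub>?R\<^esub> ?e = \<one>\<^bsub>?R\<^esub>"
    by (simp add: elt_ring_def adjoin_simps elt_mult_def L.l_minus)
  have n: "elt_neg L G leq x = ?e \<otimes>\<^bsub>?R\<^esub> x" for x by (simp add: elt_neg_def)
  show ?thesis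
  proof unfold_locales
    fix a b assume ab: "a \<in> carrier ?R" "b \<in> carrier ?R"
    show "elt_neg L G leq (a \<oplus>\<^bsub>?R\<^esub> b) = elt_neg L G leq a \<oplus>\<^bsub>?R\<^esub> elt_neg L G leq b"
      unfolding n using S.r_distr[OF ab e] .
    show "elt_neg L G leq (a \<otimes>\<^bsub>?R\<^esub> b) = a \<otimes>\<^bsub>?R\<^esub> elt_neg L G leq b"
      unfolding n using M.m_lcomm[OF e ab] .
    show "elt_neg L G leq (a \<otimes>\<^bsub>?R\<^esub> b) = elt_neg L G leq a \<otimes>\<^bsub>?R\<^esub> b"
      unfolding n using S.m_assoc[OF e ab] by (rule sym)
  next
    fix a assume a: "a \<in> carrier ?R"
    show "elt_neg L G leq a \<in> carrier ?R" unfolding n using S.m_closed[OF e a] .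
    show "elt_neg L G leq (elt_neg L G leq a) = a"
      unfolding n using S.m_assoc[OF e e a] ee S.l_one[OF a] by simp
  next
    show "elt_neg L G leq \<zero>\<^bsub>?R\<^esub> = \<zero>\<^bsub>?R\<^esub>" unfolding n using S.r_null[OF e] .
  qed
qed

end

end

theory Submission
  imports Defs "HOL-Algebra.Weak_Morphisms" "HOL-Algebra.Subrings" "HOL-Library.Countable_Set"
begin

text \<open>
  An ELT element \<open>(l, a)\<close> behaves like the leading term \<open>l t\<^sup>a\<close> of an element of the group ring
  \<open>L[t\<^sup>F]\<close>, with one difference: when leading coefficients cancel, the group ring forgets the
  exponent, whereas the ELT sum keeps it with layer \<open>0\<close>. Let \<open>P\<close> take the value
  \<open>(l, a)\<close> at the ELT elements \<open>(l\<^sub>i, a\<^sub>i)\<close>, and evaluate \<open>P\<close> also in the group ring, at the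
  monomials with coefficients \<open>l\<^sub>i\<close> and exponents \<open>a\<^sub>i\<close>. Then in the result the coefficient of
  \<open>t\<^sup>a\<close> is \<open>l\<close>, and no exponent larger than \<open>a\<close> occurs. This relation is \<open>leads\<close>. It determines
  \<open>l\<close> once \<open>a\<close> is known, and \<open>a\<close> is the max-plus value of \<open>P\<close> at the \<open>a\<^sub>i\<close>, because forgetting
  layers is a homomorphism that turns the negation map into the identity (\<open>value_eval_poly\<close>). The tropical identity makes the exponents of \<open>P\<close> and
  \<open>Q\<close> agree, the ring identity makes the elements of the group ring agree, and hence the ELT
  values agree (\<open>leads_unique\<close>).

  The group ring is replaced by its regular representation: \<open>l t\<^sup>a\<close> becomes the operator on
  functions \<open>F \<rightarrow> L\<close> that translates by \<open>a\<close> and multiplies by \<open>l\<close>. Composition of additive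
  operators is associative and distributive without any convolution sums, these particular
  operators commute, and the coefficients are recovered by applying an operator to the indicator
  function of the neutral element. Statements about leading terms then become statements about the
  action on functions, which go through by induction on the expression (\<open>leads_eval_pos\<close>).

  Both hypotheses speak only of structures on one given infinite type. A single evaluation takes
  place in the countable substructure generated by the chosen point, and this can be copied into
  any infinite type. In this way the ring identity holds for pairwise commuting elements of
  every ring (\<open>identity_at_commuting_elements\<close>), and the tropical identity over every totally
  ordered abelian group (\<open>tropical_identity_transfer\<close>).
\<close>


section \<open>Evaluation of polynomial expressions\<close>

lemma eval_pos_cong:
  "(\<And>i. i \<in> pos_vars p \<Longrightarrow> r i = s i) \<Longrightarrow> eval_pos R r p = eval_pos R s p"
  by (induction p) auto

lemma eval_poly_cong:
  "(\<And>i. i \<in> poly_vars P \<Longrightarrow> r i = s i) \<Longrightarrow> eval_poly R neg r P = eval_poly R neg s P"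
  unfolding eval_poly_def poly_vars_def
  by (metis UnI1 UnI2 eval_pos_cong)

lemma (in semiring) eval_pos_closed:
  "(\<And>i. r i \<in> carrier R) \<Longrightarrow> eval_pos R r p \<in> carrier R"
  by (induction p) auto

text \<open>
  The set \<open>A\<close> in place of the carrier allows maps that respect the operations on a substructure
  only, without introducing that substructure as a record of its own.
\<close>

lemma eval_pos_hom:
  assumes "\<And>i. r i \<in> A" "\<zero>\<^bsub>R\<^esub> \<in> A" "\<one>\<^bsub>R\<^esub> \<in> A"
    and "\<And>x y. x \<in> A \<Longrightarrow> y \<in> A \<Longrightarrow> x \<oplus>\<^bsub>R\<^esub> y \<in> A"
    and "\<And>x y. x \<in> A \<Longrightarrow> y \<in> A \<Longrightarrow> x \<otimes>\<^bsub>R\<^esub> y \<in> A"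
    and "h \<zero>\<^bsub>R\<^esub> = \<zero>\<^bsub>S\<^esub>" "h \<one>\<^bsub>R\<^esub> = \<one>\<^bsub>S\<^esub>"
    and "\<And>x y. x \<in> A \<Longrightarrow> y \<in> A \<Longrightarrow> h (x \<oplus>\<^bsub>R\<^esub> y) = h x \<oplus>\<^bsub>S\<^esub> h y"
    and "\<And>x y. x \<in> A \<Longrightarrow> y \<in> A \<Longrightarrow> h (x \<otimes>\<^bsub>R\<^esub> y) = h x \<otimes>\<^bsub>S\<^esub> h y"
  shows "eval_pos R r p \<in> A \<and> h (eval_pos R r p) = eval_pos S (h \<circ> r) p"
  by (induction p) (use assms in auto)

lemma eval_poly_ring_hom:
  assumes "ring_hom_ring R S h" "\<And>i. r i \<in> carrier R"
  shows "h (eval_poly R (\<lambda>a. \<ominus>\<^bsub>R\<^esub> a) r P) = eval_poly S (\<lambda>a. \<ominus>\<^bsub>S\<^esub> a) (h \<circ> r) P"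
proof -
  interpret ring_hom_ring R S h by fact
  have "eval_pos R r p \<in> carrier R \<and> h (eval_pos R r p) = eval_pos S (h \<circ> r) p" for p
    by (rule eval_pos_hom) (use assms(2) in auto)
  then show ?thesis by (simp add: eval_poly_def)
qed


section \<open>Passing to countable substructures\<close>

instance pos_expr :: countable by countable_datatype
instance poly_expr :: countable by countable_datatype

lemma countable_embedding:
  assumes "countable A"
  obtains h :: "'a \<Rightarrow> 'b::infinite" where "inj_on h A"
proof -
  obtain g :: "nat \<Rightarrow> 'b" where "inj g"
    using infinite_countable_subset[OF infinite_UNIV] by blast
  then have "inj_on (g \<circ> to_nat_on A) A"
    using inj_on_to_nat_on[OF assms] by (auto intro: comp_inj_on inj_on_subset)
  then show ?thesis by (rule that)
qed

text \<open>The centralizer of an element is a subring.\<close>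

lemma (in ring) eval_pos_commute:
  assumes "\<And>i. r i \<in> carrier R" "x \<in> carrier R" "\<And>i. x \<otimes> r i = r i \<otimes> x"
  shows "x \<otimes> eval_pos R r p = eval_pos R r p \<otimes> x"
proof (induction p)
  case (PMult p q)
  have c: "eval_pos R r p \<in> carrier R" for p using assms(1) by (rule eval_pos_closed)
  show ?case using PMult c assms(2) by simp (metis m_assoc)
next
  case (PAdd p q)
  have c: "eval_pos R r p \<in> carrier R" for p using assms(1) by (rule eval_pos_closed)
  show ?case using PAdd c assms(2) by (simp add: l_distr r_distr)
qed (use assms in auto)

text \<open>
  The subring generated by the \<open>r i\<close> is described as a set of values, which makes it countable
  because there are countably many expressions. The formal differences mirror the ring operations,
  e.g. \<open>(a - b) (a' - b') = (a a' + b b') - (a b' + b a')\<close>.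
\<close>

lemma (in ring) subcring_eval_poly:
  assumes r: "\<And>i. r i \<in> carrier R" and comm: "\<And>i j. r i \<otimes> r j = r j \<otimes> r i"
  shows "subcring (range (eval_poly R (\<lambda>a. \<ominus> a) r)) R"
proof -
  let ?e = "eval_pos R r" and ?K = "range (eval_poly R (\<lambda>a. \<ominus> a) r)"
  have c[simp]: "?e p \<in> carrier R" for p using r by (rule eval_pos_closed)
  have cm: "?e p \<otimes> ?e q = ?e q \<otimes> ?e p" for p q
  proof (rule eval_pos_commute[OF r c])
    show "?e p \<otimes> r i = r i \<otimes> ?e p" for i
      by (rule eval_pos_commute[OF r r comm, symmetric])
  qed
  have K: "x \<in> ?K \<longleftrightarrow> (\<exists>p q. x = ?e p \<oplus> \<ominus> ?e q)" for x
    by (auto simp: eval_poly_def image_iff) (metis poly_expr.sel)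
  have KI: "?e p \<oplus> \<ominus> ?e q \<in> ?K" for p q using K by blast
  have prod: "(a \<oplus> \<ominus> b) \<otimes> (a' \<oplus> \<ominus> b') = (a \<otimes> a' \<oplus> b \<otimes> b') \<oplus> \<ominus> (a \<otimes> b' \<oplus> b \<otimes> a')"
    if "a \<in> carrier R" "b \<in> carrier R" "a' \<in> carrier R" "b' \<in> carrier R" for a b a' b'
    using that by (simp add: l_distr r_distr l_minus r_minus minus_add a_ac)
  show ?thesis
  proof (intro subcringI subringI)
    show "?K \<subseteq> carrier R" by (auto simp: eval_poly_def)
    show "\<one> \<in> ?K" using KI[of POne PZero] by simp
  next
    fix x assume "x \<in> ?K"
    then obtain p q where "x = ?e p \<oplus> \<ominus> ?e q" using K by blast
    then have "\<ominus> x = ?e q \<oplus> \<ominus> ?e p" by (simp add: minus_add a_comm)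
    then show "\<ominus> x \<in> ?K" using KI by simp
  next
    fix x y assume "x \<in> ?K" "y \<in> ?K"
    then obtain p q p' q' where xy: "x = ?e p \<oplus> \<ominus> ?e q" "y = ?e p' \<oplus> \<ominus> ?e q'"
      using K by meson
    have "x \<otimes> y = ?e (PAdd (PMult p p') (PMult q q')) \<oplus> \<ominus> ?e (PAdd (PMult p q') (PMult q p'))"
      by (simp add: xy prod)
    then show "x \<otimes> y \<in> ?K" using KI by metis
    have "x \<oplus> y = ?e (PAdd p p') \<oplus> \<ominus> ?e (PAdd q q')"
      by (simp add: xy minus_add a_ac)
    then show "x \<oplus> y \<in> ?K" using KI by metis
    show "x \<otimes> y = y \<otimes> x" by (simp only: xy prod c cm a_comm m_closed)
  qed
qed

text \<open>
  The generated subring is a countable commutative ring, so it has an isomorphic copy inside the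
  type \<open>'r\<close>, and evaluation commutes both with this isomorphism and with the inclusion.
\<close>

lemma (in ring) identity_at_commuting_elements:
  assumes hyp: "\<forall>R :: 'r::infinite ring. cring R \<longrightarrow> identity_holds R (\<lambda>a. \<ominus>\<^bsub>R\<^esub> a) m P Q"
    and r: "\<And>i. r i \<in> carrier R" and comm: "\<And>i j. r i \<otimes> r j = r j \<otimes> r i"
  shows "eval_poly R (\<lambda>a. \<ominus> a) r P = eval_poly R (\<lambda>a. \<ominus> a) r Q"
proof -
  let ?K = "range (eval_poly R (\<lambda>a. \<ominus> a) r)"
  let ?S = "R \<lparr> carrier := ?K \<rparr>"
  have sub: "subcring ?K R" using r comm by (rule subcring_eval_poly)
  then have S: "cring ?S" using subcring_iff subcringE(1) by blast
  then interpret S: cring ?S .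
  obtain h :: "'a \<Rightarrow> 'r" where h: "inj_on h ?K"
    using countable_embedding[of ?K] by (meson countable_image countableI_type)
  let ?I = "image_ring h ?S"
  have iso: "h \<in> ring_iso ?S ?I" using inj_imp_image_ring_iso[of h ?S] h by simp
  have I: "cring ?I"
    using S.ring_iso_imp_img_cring[OF iso] by (simp add: image_ring_def image_group_def monoid.defs)
  have rK: "r i \<in> carrier ?S" for i
  proof -
    have "r i = eval_poly R (\<lambda>a. \<ominus> a) r (PMinus (PVar i) PZero)"
      using r by (simp add: eval_poly_def)
    then show ?thesis by auto
  qed
  have hom: "ring_hom_ring ?S ?I h"
    using iso by (intro ring_hom_ringI2 S.ring_axioms cring.axioms(1)[OF I]) (simp add: ring_iso_def)
  have incl: "ring_hom_ring ?S R id"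
    using subcringE(1)[OF sub]
    by (intro ring_hom_ringI S.ring_axioms ring_axioms) auto
  have "h (r i) \<in> carrier ?I" for i using rK by (auto simp: image_ring_carrier)
  then have "eval_poly ?I (\<lambda>a. \<ominus>\<^bsub>?I\<^esub> a) (h \<circ> r) P = eval_poly ?I (\<lambda>a. \<ominus>\<^bsub>?I\<^esub> a) (h \<circ> r) Q"
    using hyp I by (auto simp: identity_holds_def)
  then have "h (eval_poly ?S (\<lambda>a. \<ominus>\<^bsub>?S\<^esub> a) r P) = h (eval_poly ?S (\<lambda>a. \<ominus>\<^bsub>?S\<^esub> a) r Q)"
    using eval_poly_ring_hom[OF hom rK] by simp
  moreover have "eval_poly ?S (\<lambda>a. \<ominus>\<^bsub>?S\<^esub> a) r p = eval_poly R (\<lambda>a. \<ominus> a) r p" for p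
    using eval_poly_ring_hom[OF incl rK] by simp
  ultimately show ?thesis using h by (simp add: inj_on_eq_iff)
qed

lemma map_prod_image_iff:
  assumes "inj_on h H" "x \<in> H" "y \<in> H"
  shows "(h x, h y) \<in> map_prod h h ` Restr S H \<longleftrightarrow> (x, y) \<in> S"
proof
  assume "(h x, h y) \<in> map_prod h h ` Restr S H"
  then show "(x, y) \<in> S" using assms by (auto simp: inj_on_eq_iff)
next
  assume "(x, y) \<in> S"
  then show "(h x, h y) \<in> map_prod h h ` Restr S H"
    using assms(2,3) by (intro image_eqI[of _ _ "(x, y)"]) auto
qed

context tot_ord_ab_group begin

lemma tot_ord_image:
  assumes H: "subgroup H G" and h: "inj_on h H"
  shows "tot_ord_ab_group (image_group h (G \<lparr> carrier := H \<rparr>)) (map_prod h h ` Restr leq H)"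
proof -
  let ?H = "G \<lparr> carrier := H \<rparr>"
  let ?I = "image_group h ?H"
  define le where "le = map_prod h h ` Restr leq H"
  interpret H: group ?H using H by (rule subgroup_imp_group)
  have sub: "x \<in> carrier G" if "x \<in> H" for x using H that by (rule subgroup.mem_carrier)
  interpret I: group ?I using H.inj_imp_image_group_is_group h by simp
  have mult: "h x \<otimes>\<^bsub>?I\<^esub> h y = h (x \<otimes> y)" if "x \<in> H" "y \<in> H" for x y
    using that h by (simp add: image_group_def)
  have carr: "carrier ?I = h ` H" by (simp add: image_group_def)
  have le: "(h x, h y) \<in> le \<longleftrightarrow> (x, y) \<in> leq" if "x \<in> H" "y \<in> H" for x y
    unfolding le_def using h that by (rule map_prod_image_iff)
  have le_sub: "le \<subseteq> h ` H \<times> h ` H" by (auto simp: le_def)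
  have "tot_ord_ab_group ?I le"
  proof (intro tot_ord_ab_group.intro tot_ord_ab_group_axioms.intro I.group_comm_groupI)
    fix a b assume "a \<in> carrier ?I" "b \<in> carrier ?I"
    then obtain x y where "x \<in> H" "y \<in> H" "a = h x" "b = h y" unfolding carr by blast
    then show "a \<otimes>\<^bsub>?I\<^esub> b = b \<otimes>\<^bsub>?I\<^esub> a" by (simp add: mult m_comm[OF sub sub])
  next
    have "refl_on (h ` H) le"
      by (rule refl_onI) (auto simp: le leq_linear(1) sub)
    moreover have "trans le"
    proof (rule transI)
      fix a b c assume 1: "(a, b) \<in> le" "(b, c) \<in> le"
      then obtain x y z where xyz: "x \<in> H" "y \<in> H" "z \<in> H" "a = h x" "b = h y" "c = h z"
        using le_sub by blast
      then show "(a, c) \<in> le" using 1 leq_linear(2)[of x y z] by (simp add: le)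
    qed
    moreover have "antisym le"
    proof (rule antisymI)
      fix a b assume 1: "(a, b) \<in> le" "(b, a) \<in> le"
      then obtain x y where xy: "x \<in> H" "y \<in> H" "a = h x" "b = h y" using le_sub by blast
      then show "a = b" using 1 leq_linear(3)[of x y] by (simp add: le)
    qed
    moreover have "total_on (h ` H) le"
    proof (rule total_onI)
      fix a b assume "a \<in> h ` H" "b \<in> h ` H"
      then obtain x y where "x \<in> H" "y \<in> H" "a = h x" "b = h y" by blast
      then show "(a, b) \<in> le \<or> (b, a) \<in> le" using leq_linear(4)[of x y] sub by (auto simp: le)
    qed
    ultimately show "linear_order_on (carrier ?I) le"
      using le_sub by (simp add: order_on_defs carr)
  next
    fix a b c assume 1: "(a, b) \<in> le" "c \<in> carrier ?I"
    then obtain x y z where xyz: "x \<in> H" "y \<in> H" "z \<in> H" "a = h x" "b = h y" "c = h z"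
      using le_sub unfolding carr by blast
    have "(x \<otimes> z, y \<otimes> z) \<in> leq" using 1 xyz by (simp add: le mult_mono sub)
    then show "(a \<otimes>\<^bsub>?I\<^esub> c, b \<otimes>\<^bsub>?I\<^esub> c) \<in> le"
      using xyz by (simp add: mult le subgroup.m_closed[OF H])
  qed
  then show ?thesis by (simp only: le_def)
qed

text \<open>
  The counterpart for ordered groups. The finite values of positive expressions form a countable
  submonoid \<open>V\<close>; its quotients form a countable subgroup \<open>H\<close> that contains the finite
  coordinates of the point, and \<open>H\<close> is copied into the type \<open>'g\<close> with its order.
\<close>

lemma tropical_identity_transfer:
  assumes hyp: "\<forall>(G :: 'g::infinite monoid) leq. tot_ord_ab_group G leq \<longrightarrow>
         identity_holds (max_plus G leq) (\<lambda>a. a) m P Q"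
    and r: "\<And>i. r i \<in> carrier (max_plus G leq)"
  shows "eval_poly (max_plus G leq) (\<lambda>a. a) r P = eval_poly (max_plus G leq) (\<lambda>a. a) r Q"
proof -
  let ?T = "max_plus G leq"
  let ?e = "eval_pos ?T r"
  interpret T: semiring_with_negation ?T "\<lambda>a. a" by (rule max_plus_semiring_with_negation)
  define V where "V = {x. \<exists>p. ?e p = Some x}"
  define H where "H = (\<lambda>(x, y). x \<otimes> inv y) ` (V \<times> V)"
  have V: "x \<in> carrier G" if "x \<in> V" for x
  proof -
    obtain p where "?e p = Some x" using \<open>x \<in> V\<close> unfolding V_def by blast
    moreover have "?e p \<in> carrier ?T" using r by (rule T.eval_pos_closed)
    ultimately show ?thesis by (auto simp: max_plus_def adjoin_simps)
  qed
  have V1: "\<one> \<in> V" unfolding V_def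
    by (auto simp: max_plus_def adjoin_simps intro!: exI[of _ POne])
  have Vm: "x \<otimes> y \<in> V" if "x \<in> V" "y \<in> V" for x y
  proof -
    obtain p q where "?e p = Some x" "?e q = Some y"
      using \<open>x \<in> V\<close> \<open>y \<in> V\<close> unfolding V_def by blast
    then have "?e (PMult p q) = Some (x \<otimes> y)" by (simp add: max_plus_def adjoin_simps)
    then show ?thesis unfolding V_def by blast
  qed
  have HI: "x \<otimes> inv y \<in> H" if "x \<in> V" "y \<in> V" for x y using that by (auto simp: H_def)
  have VH: "V \<subseteq> H"
  proof
    fix x assume "x \<in> V"
    then show "x \<in> H" using HI[of x \<one>] V1 V by simp
  qed
  have H: "subgroup H G"
  proof (rule subgroupI)
    show "H \<subseteq> carrier G" using V by (auto simp: H_def)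
    show "H \<noteq> {}" using V1 VH by blast
  next
    fix a assume "a \<in> H"
    then obtain x y where "x \<in> V" "y \<in> V" "a = x \<otimes> inv y" by (auto simp: H_def)
    then show "inv a \<in> H" using HI[of y x] V by (simp add: inv_mult m_comm)
  next
    fix a b assume "a \<in> H" "b \<in> H"
    then obtain x y x' y' where *: "x \<in> V" "y \<in> V" "a = x \<otimes> inv y"
      "x' \<in> V" "y' \<in> V" "b = x' \<otimes> inv y'" by (auto simp: H_def)
    then have "a \<otimes> b = (x \<otimes> x') \<otimes> inv (y \<otimes> y')" using V by (simp add: inv_mult m_ac)
    then show "a \<otimes> b \<in> H" using HI Vm * by simp
  qed
  have "V \<subseteq> range (\<lambda>p. the (?e p))"
  proof
    fix x assume "x \<in> V"
    then obtain p where "?e p = Some x" unfolding V_def by blast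
    then show "x \<in> range (\<lambda>p. the (?e p))" by (intro range_eqI[of _ _ p]) simp
  qed
  then have "countable V" by (meson countable_image countableI_type countable_subset)
  then have "countable H" by (simp add: H_def)
  then obtain h :: "'a \<Rightarrow> 'g" where h: "inj_on h H" by (rule countable_embedding)
  define I where "I = image_group h (G \<lparr> carrier := H \<rparr>)"
  define le where "le = map_prod h h ` Restr leq H"
  let ?U = "max_plus I le" and ?A = "insert None (Some ` H)"
  have ord: "tot_ord_ab_group I le" unfolding I_def le_def using H h by (rule tot_ord_image)
  have mult: "h x \<otimes>\<^bsub>I\<^esub> h y = h (x \<otimes> y)" if "x \<in> H" "y \<in> H" for x y
    using that h by (simp add: I_def image_group_def)
  have I: "carrier I = h ` H" "\<one>\<^bsub>I\<^esub> = h \<one>" by (simp_all add: I_def image_group_def)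
  have le: "(h x, h y) \<in> le \<longleftrightarrow> (x, y) \<in> leq" if "x \<in> H" "y \<in> H" for x y
    unfolding le_def using h that by (rule map_prod_image_iff)
  have rA: "r i \<in> ?A" for i
  proof (cases "r i")
    case (Some x)
    then have "?e (PVar i) = Some x" by simp
    then show ?thesis using Some VH unfolding V_def by blast
  qed simp
  have tr: "?e p \<in> ?A \<and> map_option h (?e p) = eval_pos ?U (map_option h \<circ> r) p" for p
    by (rule eval_pos_hom[OF rA])
      (auto simp: max_plus_def adjoin_simps I mult le subgroup.m_closed[OF H] subgroup.one_closed[OF H])
  have "identity_holds ?U (\<lambda>a. a) m P Q" using hyp ord by blast
  moreover have "(map_option h \<circ> r) i \<in> carrier ?U" for i
    using rA[of i] by (auto simp: max_plus_def adjoin_simps I)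
  ultimately have "eval_poly ?U (\<lambda>a. a) (map_option h \<circ> r) P
      = eval_poly ?U (\<lambda>a. a) (map_option h \<circ> r) Q"
    unfolding identity_holds_def by blast
  moreover have "eval_poly ?T (\<lambda>a. a) r p \<in> ?A \<and> map_option h (eval_poly ?T (\<lambda>a. a) r p)
      = eval_poly ?U (\<lambda>a. a) (map_option h \<circ> r) p" for p
    using tr[of "PAdd (pos_part p) (neg_part p)"] by (simp add: eval_poly_def)
  moreover have "inj_on (map_option h) ?A" using h by (auto simp: inj_on_def)
  ultimately show ?thesis by (metis (no_types, lifting) inj_onD)
qed

end


section \<open>The ring of additive endomorphisms\<close>

definition endo_ring :: "('a, 'b) ring_scheme \<Rightarrow> ('a \<Rightarrow> 'a) ring" where
  "endo_ring M =
    \<lparr> carrier = {t \<in> carrier M \<rightarrow>\<^sub>E carrier M.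
        \<forall>x\<in>carrier M. \<forall>y\<in>carrier M. t (x \<oplus>\<^bsub>M\<^esub> y) = t x \<oplus>\<^bsub>M\<^esub> t y},
      monoid.mult = compose (carrier M),
      one = (\<lambda>x\<in>carrier M. x),
      zero = (\<lambda>x\<in>carrier M. \<zero>\<^bsub>M\<^esub>),
      add = (\<lambda>s t. \<lambda>x\<in>carrier M. s x \<oplus>\<^bsub>M\<^esub> t x) \<rparr>"

lemma endo_ring_simps:
  "t \<in> carrier (endo_ring M) \<longleftrightarrow> t \<in> carrier M \<rightarrow>\<^sub>E carrier M \<and>
     (\<forall>x\<in>carrier M. \<forall>y\<in>carrier M. t (x \<oplus>\<^bsub>M\<^esub> y) = t x \<oplus>\<^bsub>M\<^esub> t y)"
  "s \<otimes>\<^bsub>endo_ring M\<^esub> t = compose (carrier M) s t"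
  "\<one>\<^bsub>endo_ring M\<^esub> = (\<lambda>x\<in>carrier M. x)"
  "\<zero>\<^bsub>endo_ring M\<^esub> = (\<lambda>x\<in>carrier M. \<zero>\<^bsub>M\<^esub>)"
  "s \<oplus>\<^bsub>endo_ring M\<^esub> t = (\<lambda>x\<in>carrier M. s x \<oplus>\<^bsub>M\<^esub> t x)"
  by (simp_all add: endo_ring_def)

lemma (in abelian_group) ring_endo_ring: "ring (endo_ring G)"
proof -
  let ?E = "endo_ring G"
  have eqI: "s = t" if "s \<in> carrier ?E" "t \<in> carrier ?E" "\<And>x. x \<in> carrier G \<Longrightarrow> s x = t x" for s t
    using that by (intro PiE_ext[of s "carrier G" "\<lambda>_. carrier G" t]) (simp_all add: endo_ring_simps)
  have app: "t x \<in> carrier G" if "t \<in> carrier ?E" "x \<in> carrier G" for t x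
    using that by (auto simp: endo_ring_simps)
  have hom: "t (x \<oplus> y) = t x \<oplus> t y" if "t \<in> carrier ?E" "x \<in> carrier G" "y \<in> carrier G" for t x y
    using that by (simp add: endo_ring_simps)
  have EI: "restrict t (carrier G) \<in> carrier ?E"
    if "\<And>x. x \<in> carrier G \<Longrightarrow> t x \<in> carrier G"
      and "\<And>x y. x \<in> carrier G \<Longrightarrow> y \<in> carrier G \<Longrightarrow> t (x \<oplus> y) = t x \<oplus> t y" for t
    using that by (simp add: endo_ring_simps)
  have mult: "s \<otimes>\<^bsub>?E\<^esub> t \<in> carrier ?E" and add: "s \<oplus>\<^bsub>?E\<^esub> t \<in> carrier ?E"
    if "s \<in> carrier ?E" "t \<in> carrier ?E" for s t
    using that unfolding endo_ring_simps(2,5) compose_def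
    by (auto intro!: EI simp: app hom a_ac)
  have one: "\<one>\<^bsub>?E\<^esub> \<in> carrier ?E" and zero: "\<zero>\<^bsub>?E\<^esub> \<in> carrier ?E"
    unfolding endo_ring_simps(3,4) by (auto intro!: EI)
  note ops = endo_ring_simps(2-5) compose_def
  show ?thesis
  proof (rule ringI)
    show "abelian_group ?E"
    proof (rule abelian_groupI)
      fix t assume t: "t \<in> carrier ?E"
      have neg: "(\<lambda>x\<in>carrier G. \<ominus> t x) \<in> carrier ?E"
        using t by (auto intro!: EI simp: app hom minus_add)
      have "(\<lambda>x\<in>carrier G. \<ominus> t x) \<oplus>\<^bsub>?E\<^esub> t = \<zero>\<^bsub>?E\<^esub>"
        by (rule eqI[OF add[OF neg t] zero]) (simp add: ops app t l_neg)
      then show "\<exists>s\<in>carrier ?E. s \<oplus>\<^bsub>?E\<^esub> t = \<zero>\<^bsub>?E\<^esub>" using neg by blast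
      show "\<zero>\<^bsub>?E\<^esub> \<oplus>\<^bsub>?E\<^esub> t = t"
        by (rule eqI[OF add[OF zero t] t]) (simp add: ops app t)
    next
      fix s t u assume *: "s \<in> carrier ?E" "t \<in> carrier ?E" "u \<in> carrier ?E"
      show "(s \<oplus>\<^bsub>?E\<^esub> t) \<oplus>\<^bsub>?E\<^esub> u = s \<oplus>\<^bsub>?E\<^esub> (t \<oplus>\<^bsub>?E\<^esub> u)"
        by (rule eqI) (simp_all add: add *, simp add: ops app * a_assoc)
    next
      fix s t assume *: "s \<in> carrier ?E" "t \<in> carrier ?E"
      show "s \<oplus>\<^bsub>?E\<^esub> t = t \<oplus>\<^bsub>?E\<^esub> s"
        by (rule eqI) (simp_all add: add *, simp add: ops app * a_comm)
    qed (simp_all add: zero add)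
    show "monoid ?E"
    proof (rule monoidI)
      fix s t u assume *: "s \<in> carrier ?E" "t \<in> carrier ?E" "u \<in> carrier ?E"
      show "(s \<otimes>\<^bsub>?E\<^esub> t) \<otimes>\<^bsub>?E\<^esub> u = s \<otimes>\<^bsub>?E\<^esub> (t \<otimes>\<^bsub>?E\<^esub> u)"
        by (rule eqI) (simp_all add: mult *, simp add: ops app *)
    next
      fix t assume t: "t \<in> carrier ?E"
      show "\<one>\<^bsub>?E\<^esub> \<otimes>\<^bsub>?E\<^esub> t = t"
        by (rule eqI[OF mult[OF one t] t]) (simp add: ops app t)
      show "t \<otimes>\<^bsub>?E\<^esub> \<one>\<^bsub>?E\<^esub> = t"
        by (rule eqI[OF mult[OF t one] t]) (simp add: ops app t)
    qed (simp_all add: one mult)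
  next
    fix s t u assume *: "s \<in> carrier ?E" "t \<in> carrier ?E" "u \<in> carrier ?E"
    show "(s \<oplus>\<^bsub>?E\<^esub> t) \<otimes>\<^bsub>?E\<^esub> u = s \<otimes>\<^bsub>?E\<^esub> u \<oplus>\<^bsub>?E\<^esub> t \<otimes>\<^bsub>?E\<^esub> u"
      by (rule eqI) (simp_all add: mult add *, simp add: ops app *)
    show "u \<otimes>\<^bsub>?E\<^esub> (s \<oplus>\<^bsub>?E\<^esub> t) = u \<otimes>\<^bsub>?E\<^esub> s \<oplus>\<^bsub>?E\<^esub> u \<otimes>\<^bsub>?E\<^esub> t"
      by (rule eqI) (simp_all add: mult add *, simp add: ops app hom *)
  qed
qed

definition fun_ring :: "'i set \<Rightarrow> ('a, 'b) ring_scheme \<Rightarrow> ('i \<Rightarrow> 'a) ring" where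
  "fun_ring I L =
    \<lparr> carrier = I \<rightarrow>\<^sub>E carrier L,
      monoid.mult = (\<lambda>f g. \<lambda>c\<in>I. f c \<otimes>\<^bsub>L\<^esub> g c),
      one = (\<lambda>c\<in>I. \<one>\<^bsub>L\<^esub>),
      zero = (\<lambda>c\<in>I. \<zero>\<^bsub>L\<^esub>),
      add = (\<lambda>f g. \<lambda>c\<in>I. f c \<oplus>\<^bsub>L\<^esub> g c) \<rparr>"

lemma fun_ring_simps:
  "carrier (fun_ring I L) = I \<rightarrow>\<^sub>E carrier L"
  "\<zero>\<^bsub>fun_ring I L\<^esub> = (\<lambda>c\<in>I. \<zero>\<^bsub>L\<^esub>)"
  "f \<oplus>\<^bsub>fun_ring I L\<^esub> g = (\<lambda>c\<in>I. f c \<oplus>\<^bsub>L\<^esub> g c)"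
  by (simp_all add: fun_ring_def)

lemma (in abelian_group) abelian_group_fun_ring: "abelian_group (fun_ring I G)"
proof -
  let ?M = "fun_ring I G"
  have eqI: "f = g" if "f \<in> carrier ?M" "g \<in> carrier ?M" "\<And>c. c \<in> I \<Longrightarrow> f c = g c" for f g
    using that by (intro PiE_ext[of f I "\<lambda>_. carrier G" g]) (simp_all add: fun_ring_simps)
  have app: "f c \<in> carrier G" if "f \<in> carrier ?M" "c \<in> I" for f c
    using that by (auto simp: fun_ring_simps)
  have MI: "restrict f I \<in> carrier ?M" if "\<And>c. c \<in> I \<Longrightarrow> f c \<in> carrier G" for f
    using that by (simp add: fun_ring_simps)
  have add: "f \<oplus>\<^bsub>?M\<^esub> g \<in> carrier ?M" if "f \<in> carrier ?M" "g \<in> carrier ?M" for f g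
    using that unfolding fun_ring_simps(3) by (auto intro!: MI simp: app)
  have zero: "\<zero>\<^bsub>?M\<^esub> \<in> carrier ?M" unfolding fun_ring_simps(2) by (auto intro!: MI)
  note ops = fun_ring_simps(2,3)
  show ?thesis
  proof (rule abelian_groupI)
    fix f assume f: "f \<in> carrier ?M"
    have neg: "(\<lambda>c\<in>I. \<ominus> f c) \<in> carrier ?M" using f by (auto intro!: MI simp: app)
    have "(\<lambda>c\<in>I. \<ominus> f c) \<oplus>\<^bsub>?M\<^esub> f = \<zero>\<^bsub>?M\<^esub>"
      by (rule eqI[OF add[OF neg f] zero]) (simp add: ops app f l_neg)
    then show "\<exists>g\<in>carrier ?M. g \<oplus>\<^bsub>?M\<^esub> f = \<zero>\<^bsub>?M\<^esub>" using neg by blast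
    show "\<zero>\<^bsub>?M\<^esub> \<oplus>\<^bsub>?M\<^esub> f = f"
      by (rule eqI[OF add[OF zero f] f]) (simp add: ops app f)
  next
    fix f g k assume *: "f \<in> carrier ?M" "g \<in> carrier ?M" "k \<in> carrier ?M"
    show "(f \<oplus>\<^bsub>?M\<^esub> g) \<oplus>\<^bsub>?M\<^esub> k = f \<oplus>\<^bsub>?M\<^esub> (g \<oplus>\<^bsub>?M\<^esub> k)"
      by (rule eqI) (simp_all add: add *, simp add: ops app * a_assoc)
  next
    fix f g assume *: "f \<in> carrier ?M" "g \<in> carrier ?M"
    show "f \<oplus>\<^bsub>?M\<^esub> g = g \<oplus>\<^bsub>?M\<^esub> f"
      by (rule eqI) (simp_all add: add *, simp add: ops app * a_comm)
  qed (simp_all add: zero add)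
qed


section \<open>Leading terms\<close>

locale elt_structure = tot_ord_ab_group F leq + L: cring L
  for F (structure) and leq and L (structure)
begin

abbreviation "M \<equiv> fun_ring (carrier F) L"
abbreviation "E \<equiv> endo_ring M"
abbreviation "ELT \<equiv> elt_ring L F leq"

sublocale E: ring E
  by (intro abelian_group.ring_endo_ring abelian_group.abelian_group_fun_ring L.abelian_group_axioms)

sublocale ELT: semiring ELT
  by (intro elt_ring_semiring L.cring_axioms)

lemma ELT_carrier: "carrier ELT = insert None (Some ` (carrier L \<times> carrier F))"
  by (simp add: elt_ring_def adjoin_simps)

text \<open>
  The action of the group ring element \<open>l t\<^sup>a\<close> on functions \<open>F \<rightarrow> L\<close>, read as possibly infinite
  formal sums of powers of \<open>t\<close>: with \<open>F\<close> written additively, multiplication by \<open>t\<^sup>a\<close> moves the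
  coefficient of \<open>t\<close> at exponent \<open>c - a\<close> to exponent \<open>c\<close>. The element \<open>-\<infinity>\<close> acts as zero.
\<close>

primrec translate :: "('c \<times> 'a) option \<Rightarrow> ('a \<Rightarrow> 'c) \<Rightarrow> ('a \<Rightarrow> 'c)" where
  "translate None = (\<lambda>f\<in>carrier M. \<lambda>c\<in>carrier F. \<zero>\<^bsub>L\<^esub>)"
| "translate (Some x) =
     (\<lambda>f\<in>carrier M. \<lambda>c\<in>carrier F. fst x \<otimes>\<^bsub>L\<^esub> f (inv\<^bsub>F\<^esub> snd x \<otimes>\<^bsub>F\<^esub> c))"

lemma M_app: "f \<in> carrier M \<Longrightarrow> c \<in> carrier F \<Longrightarrow> f c \<in> carrier L"
  by (auto simp: fun_ring_simps)

lemma M_restrict: "(\<And>c. c \<in> carrier F \<Longrightarrow> f c \<in> carrier L) \<Longrightarrow> restrict f (carrier F) \<in> carrier M"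
  by (simp add: fun_ring_simps)

lemma E_app: "t \<in> carrier E \<Longrightarrow> f \<in> carrier M \<Longrightarrow> t f \<in> carrier M"
  by (auto simp: endo_ring_simps)

lemma translate_in_M:
  assumes "x \<in> carrier ELT" "f \<in> carrier M"
  shows "translate x f \<in> carrier M"
  using assms by (cases x) (auto simp: ELT_carrier M_app intro!: M_restrict)

lemma translate_closed:
  assumes x: "x \<in> carrier ELT"
  shows "translate x \<in> carrier E"
proof -
  have "translate x (f \<oplus>\<^bsub>M\<^esub> g) = translate x f \<oplus>\<^bsub>M\<^esub> translate x g"
    if fg: "f \<in> carrier M" "g \<in> carrier M" for f g
  proof -
    have "f \<oplus>\<^bsub>M\<^esub> g \<in> carrier M" using fg unfolding fun_ring_simps(3) by (intro M_restrict) (simp add: M_app)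
    then show ?thesis
      using x fg by (cases x) (auto simp: ELT_carrier fun_ring_simps(3) M_app L.r_distr intro!: restrict_ext)
  qed
  moreover have "translate x \<in> extensional (carrier M)" by (cases x) simp_all
  ultimately show ?thesis using translate_in_M[OF x] by (simp add: endo_ring_simps(1) PiE_def)
qed

lemma translate_commute:
  assumes xy: "x \<in> carrier ELT" "y \<in> carrier ELT"
  shows "translate x \<otimes>\<^bsub>E\<^esub> translate y = translate y \<otimes>\<^bsub>E\<^esub> translate x"
  unfolding endo_ring_simps(2) compose_def
proof (rule restrict_ext)
  fix f assume f: "f \<in> carrier M"
  have "translate x f \<in> carrier M" "translate y f \<in> carrier M"
    using xy f by (auto intro: translate_in_M)
  then show "translate x (translate y f) = translate y (translate x f)"
    using xy f
    by (cases x; cases y) (auto simp: ELT_carrier M_app L.m_lcomm m_lcomm intro!: restrict_ext)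
qed

text \<open>
  The coefficient at the tangible value is allowed to vanish. With the usual notion of leading term,
  cancellation would break the compatibility with ELT addition.
\<close>

primrec leads :: "('a \<Rightarrow> 'c) \<Rightarrow> ('c \<times> 'a) option \<Rightarrow> bool" where
  "leads f None \<longleftrightarrow> (\<forall>c\<in>carrier F. f c = \<zero>\<^bsub>L\<^esub>)"
| "leads f (Some x) \<longleftrightarrow> f (snd x) = fst x \<and> (\<forall>c\<in>carrier F. (c, snd x) \<notin> leq \<longrightarrow> f c = \<zero>\<^bsub>L\<^esub>)"

lemma leads_add:
  assumes "f \<in> carrier M" "g \<in> carrier M" "x \<in> carrier ELT" "y \<in> carrier ELT" "leads f x" "leads g y"
  shows "leads (f \<oplus>\<^bsub>M\<^esub> g) (x \<oplus>\<^bsub>ELT\<^esub> y)"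
proof (cases "x = None \<or> y = None")
  case True
  then show ?thesis
    using assms by (auto simp: ELT_carrier elt_ring_def adjoin_simps fun_ring_simps PiE_mem)
next
  case False
  then obtain l a k b where xy: "x = Some (l, a)" "y = Some (k, b)"
    "l \<in> carrier L" "a \<in> carrier F" "k \<in> carrier L" "b \<in> carrier F"
    using assms(3,4) by (auto simp: ELT_carrier)
  consider "a = b" | "a \<noteq> b" "(a, b) \<in> leq" "(b, a) \<notin> leq" | "a \<noteq> b" "(b, a) \<in> leq" "(a, b) \<notin> leq"
    using xy leq_linear(3,4) by blast
  then show ?thesis
  proof cases
    case 1
    then show ?thesis
      using assms(5,6) xy by (auto simp: elt_ring_def adjoin_simps elt_add_def fun_ring_simps)
  next
    case 2
    then show ?thesis
      using assms(5,6) xy leq_linear(2)[of _ a b]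
      by (auto simp: elt_ring_def adjoin_simps elt_add_def fun_ring_simps)
  next
    case 3
    then show ?thesis
      using assms(5,6) xy leq_linear(2)[of _ b a]
      by (auto simp: elt_ring_def adjoin_simps elt_add_def fun_ring_simps)
  qed
qed

lemma leads_translate:
  assumes "f \<in> carrier M" "x \<in> carrier ELT" "y \<in> carrier ELT" "leads f y"
  shows "leads (translate x f) (x \<otimes>\<^bsub>ELT\<^esub> y)"
proof (cases "x = None \<or> y = None")
  case True
  then show ?thesis
    using assms by (auto simp: ELT_carrier elt_ring_def adjoin_simps fun_ring_simps)
next
  case False
  then obtain l a k b where xy: "x = Some (l, a)" "y = Some (k, b)"
    "l \<in> carrier L" "a \<in> carrier F" "k \<in> carrier L" "b \<in> carrier F"
    using assms(2,3) by (auto simp: ELT_carrier)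
  have "inv\<^bsub>F\<^esub> a \<otimes>\<^bsub>F\<^esub> (a \<otimes>\<^bsub>F\<^esub> b) = b" using xy by (simp flip: m_assoc)
  moreover have "(inv\<^bsub>F\<^esub> a \<otimes>\<^bsub>F\<^esub> c, b) \<notin> leq"
    if "c \<in> carrier F" "(c, a \<otimes>\<^bsub>F\<^esub> b) \<notin> leq" for c
  proof
    assume "(inv\<^bsub>F\<^esub> a \<otimes>\<^bsub>F\<^esub> c, b) \<in> leq"
    then have "((inv\<^bsub>F\<^esub> a \<otimes>\<^bsub>F\<^esub> c) \<otimes>\<^bsub>F\<^esub> a, b \<otimes>\<^bsub>F\<^esub> a) \<in> leq" using xy mult_mono by blast
    moreover have "(inv\<^bsub>F\<^esub> a \<otimes>\<^bsub>F\<^esub> c) \<otimes>\<^bsub>F\<^esub> a = c"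
      using xy that by (simp add: m_comm flip: m_assoc)
    ultimately show False using that xy by (simp add: m_comm)
  qed
  ultimately show ?thesis
    using assms(1,4) xy by (auto simp: elt_ring_def adjoin_simps elt_mult_def fun_ring_simps)
qed

text \<open>
  The function \<open>f\<close> has to be arbitrary: a product acts as a composition, so the induction hypothesis
  for the left factor is applied to the result of the right factor.
\<close>

lemma leads_eval_pos:
  assumes r: "\<And>i. r i \<in> carrier ELT"
  shows "f \<in> carrier M \<Longrightarrow> y \<in> carrier ELT \<Longrightarrow> leads f y \<Longrightarrow>
    leads (eval_pos E (\<lambda>i. translate (r i)) p f) (eval_pos ELT r p \<otimes>\<^bsub>ELT\<^esub> y)"
proof (induction p arbitrary: f y)
  case PZero
  have "\<zero>\<^bsub>ELT\<^esub> = None" "None \<otimes>\<^bsub>ELT\<^esub> y = None" by (simp_all add: elt_ring_def adjoin_simps)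
  then show ?case using PZero by (simp add: endo_ring_simps(4) fun_ring_simps(2))
next
  case POne
  then show ?case by (simp add: endo_ring_simps(3))
next
  case (PVar i)
  then show ?case using r by (simp add: leads_translate)
next
  case (PAdd p q)
  let ?e = "eval_pos E (\<lambda>i. translate (r i))" and ?v = "eval_pos ELT r"
  have c: "?e p f \<in> carrier M" for p
    by (rule E_app[OF E.eval_pos_closed[OF translate_closed[OF r]] PAdd.prems(1)])
  have v: "?v p \<in> carrier ELT" for p using r by (rule ELT.eval_pos_closed)
  have "leads (?e p f \<oplus>\<^bsub>M\<^esub> ?e q f) (?v p \<otimes>\<^bsub>ELT\<^esub> y \<oplus>\<^bsub>ELT\<^esub> ?v q \<otimes>\<^bsub>ELT\<^esub> y)"
    using PAdd by (intro leads_add c ELT.m_closed v)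
  then show ?case using PAdd.prems by (simp add: endo_ring_simps(5) ELT.l_distr v)
next
  case (PMult p q)
  let ?e = "eval_pos E (\<lambda>i. translate (r i))" and ?v = "eval_pos ELT r"
  have c: "?e q f \<in> carrier M"
    by (rule E_app[OF E.eval_pos_closed[OF translate_closed[OF r]] PMult.prems(1)])
  have v: "?v p \<in> carrier ELT" for p using r by (rule ELT.eval_pos_closed)
  have "leads (?e p (?e q f)) (?v p \<otimes>\<^bsub>ELT\<^esub> (?v q \<otimes>\<^bsub>ELT\<^esub> y))"
    using PMult by (intro PMult.IH c ELT.m_closed v)
  then show ?case using PMult.prems by (simp add: endo_ring_simps(2) compose_def ELT.m_assoc v)
qed

lemma E_minus_apply:
  assumes t: "t \<in> carrier E" and f: "f \<in> carrier M" and c: "c \<in> carrier F"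
  shows "(\<ominus>\<^bsub>E\<^esub> t) f c = \<ominus>\<^bsub>L\<^esub> t f c"
proof (rule L.minus_equality[symmetric])
  have "(\<ominus>\<^bsub>E\<^esub> t) f c \<oplus>\<^bsub>L\<^esub> t f c = (\<ominus>\<^bsub>E\<^esub> t \<oplus>\<^bsub>E\<^esub> t) f c"
    using f c by (simp only: endo_ring_simps(5) fun_ring_simps(3) restrict_apply' simp_thms)
  also have "\<dots> = \<zero>\<^bsub>L\<^esub>"
    unfolding E.l_neg[OF t] using f c by (simp only: endo_ring_simps(4) fun_ring_simps(2) restrict_apply')
  finally show "(\<ominus>\<^bsub>E\<^esub> t) f c \<oplus>\<^bsub>L\<^esub> t f c = \<zero>\<^bsub>L\<^esub>" .
  show "t f c \<in> carrier L" by (rule M_app[OF E_app[OF t f] c])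
  show "(\<ominus>\<^bsub>E\<^esub> t) f c \<in> carrier L" by (rule M_app[OF E_app[OF E.a_inv_closed[OF t] f] c])
qed

lemma leads_minus:
  assumes t: "t \<in> carrier E" and f: "f \<in> carrier M" and x: "x \<in> carrier ELT" and l: "leads (t f) x"
  shows "leads ((\<ominus>\<^bsub>E\<^esub> t) f) (elt_neg L F leq x)"
proof (cases x)
  case None
  have "elt_neg L F leq None = None"
    by (simp add: elt_neg_def elt_ring_def adjoin_simps)
  then show ?thesis using l None by (simp add: E_minus_apply[OF t f])
next
  case (Some z)
  then show ?thesis
    using l x by (auto simp: ELT_carrier elt_neg_simps[OF L.cring_axioms] E_minus_apply[OF t f])
qed

lemma leads_eval_poly:
  assumes r: "\<And>i. r i \<in> carrier ELT" and f: "f \<in> carrier M" and f1: "leads f \<one>\<^bsub>ELT\<^esub>"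
  shows "leads (eval_poly E (\<lambda>t. \<ominus>\<^bsub>E\<^esub> t) (\<lambda>i. translate (r i)) P f)
    (eval_poly ELT (elt_neg L F leq) r P)"
proof -
  let ?e = "eval_pos E (\<lambda>i. translate (r i))" and ?v = "eval_pos ELT r"
  interpret N: semiring_with_negation ELT "elt_neg L F leq"
    by (rule elt_ring_semiring_with_negation[OF L.cring_axioms])
  have e: "?e p \<in> carrier E" for p by (intro E.eval_pos_closed translate_closed r)
  have v: "?v p \<in> carrier ELT" for p using r by (rule ELT.eval_pos_closed)
  have l: "leads (?e p f) (?v p)" for p
    using leads_eval_pos[where r = r and p = p, OF r f ELT.one_closed f1] v by simp
  have "leads (?e p f \<oplus>\<^bsub>M\<^esub> (\<ominus>\<^bsub>E\<^esub> ?e q) f) (?v p \<oplus>\<^bsub>ELT\<^esub> elt_neg L F leq (?v q))" for p q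
    by (rule leads_add[OF E_app[OF e f] E_app[OF E.a_inv_closed[OF e] f] v N.neg_closed[OF v] l
          leads_minus[OF e f v l]])
  then show ?thesis using f by (simp add: eval_poly_def endo_ring_simps(5))
qed

text \<open>
  This is where the two hypotheses of the theorem meet: the ring identity provides the common function
  \<open>f\<close>, the tropical identity the common tangible value.
\<close>

lemma leads_unique:
  "leads f x \<Longrightarrow> leads f y \<Longrightarrow> map_option snd x = map_option snd y \<Longrightarrow> x = y"
  by (cases x; cases y) (auto intro: prod_eqI)

text \<open>
  A sum of ELT elements keeps the larger tangible value even if the layers cancel, so dropping the
  layers is a homomorphism to the max-plus algebra; negation changes the layer only.
\<close>

lemma value_eval_poly:
  assumes r: "\<And>i. r i \<in> carrier ELT"
  shows "map_option snd (eval_poly ELT (elt_neg L F leq) r P)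
    = eval_poly (max_plus F leq) (\<lambda>a. a) (map_option snd \<circ> r) P"
proof -
  let ?T = "max_plus F leq"
  interpret N: semiring_with_negation ELT "elt_neg L F leq"
    by (rule elt_ring_semiring_with_negation[OF L.cring_axioms])
  have add: "map_option snd (x \<oplus>\<^bsub>ELT\<^esub> y) = map_option snd x \<oplus>\<^bsub>?T\<^esub> map_option snd y"
    if "x \<in> carrier ELT" "y \<in> carrier ELT" for x y
    using that leq_linear(1)
    by (cases x; cases y)
      (auto simp: ELT_carrier elt_ring_def max_plus_def adjoin_simps elt_add_def)
  have mult: "map_option snd (x \<otimes>\<^bsub>ELT\<^esub> y) = map_option snd x \<otimes>\<^bsub>?T\<^esub> map_option snd y" for x y
    by (cases x; cases y)
      (auto simp: elt_ring_def max_plus_def adjoin_simps elt_mult_def split: prod.splits)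
  have neg: "map_option snd (elt_neg L F leq x) = map_option snd x" if "x \<in> carrier ELT" for x
    using that unfolding ELT_carrier
    by (cases x) (auto simp: elt_neg_simps[OF L.cring_axioms] elt_neg_def elt_ring_def adjoin_simps elt_mult_def)
  have const: "map_option snd \<zero>\<^bsub>ELT\<^esub> = \<zero>\<^bsub>?T\<^esub>" "map_option snd \<one>\<^bsub>ELT\<^esub> = \<one>\<^bsub>?T\<^esub>"
    by (simp_all add: elt_ring_def max_plus_def adjoin_simps)
  have v: "eval_pos ELT r p \<in> carrier ELT \<and>
      map_option snd (eval_pos ELT r p) = eval_pos ?T (map_option snd \<circ> r) p" for p
    by (rule eval_pos_hom[where A = "carrier ELT"])
      (simp_all only: r ELT.zero_closed ELT.one_closed ELT.add.m_closed ELT.m_closed add mult const)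
  show ?thesis
    using v[of "pos_part P"] v[of "neg_part P"] by (simp only: eval_poly_def add neg N.neg_closed)
qed

end

section \<open>Identities of ELT rings\<close>

theorem theorem2p9:
  fixes m :: nat and P Q :: poly_expr
  assumes "poly_vars P \<subseteq> {1..m}" and "poly_vars Q \<subseteq> {1..m}"
    and comm_rings:
      "\<forall>R :: 'r::infinite ring. cring R \<longrightarrow> identity_holds R (\<lambda>a. \<ominus>\<^bsub>R\<^esub> a) m P Q"
    and tropical:
      "\<forall>(G :: 'g::infinite monoid) leq. tot_ord_ab_group G leq \<longrightarrow>
         identity_holds (max_plus G leq) (\<lambda>a. a) m P Q"
  shows "\<forall>(L :: 'l ring) (F :: 'f monoid) leq. cring L \<longrightarrow> tot_ord_ab_group F leq \<longrightarrow>
           identity_holds (elt_ring L F leq) (elt_neg L F leq) m P Q"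
proof (intro allI impI)
  fix L :: "'l ring" and F :: "'f monoid" and leq
  assume "cring L" "tot_ord_ab_group F leq"
  then interpret elt_structure F leq L by (simp add: elt_structure_def)
  show "identity_holds ELT (elt_neg L F leq) m P Q"
    unfolding identity_holds_def
  proof (intro allI impI)
    fix s :: "nat \<Rightarrow> ('l \<times> 'f) option" assume s: "\<forall>i\<in>{1..m}. s i \<in> carrier ELT"
    \<comment> \<open>The given point is only constrained at the variables \<open>1, \<dots>, m\<close>; elsewhere it may leave the carrier.\<close>
    define r where "r i = (if i \<in> {1..m} then s i else None)" for i
    have r: "r i \<in> carrier ELT" for i using s by (auto simp: r_def ELT_carrier)
    let ?P = "eval_poly ELT (elt_neg L F leq) r P" and ?Q = "eval_poly ELT (elt_neg L F leq) r Q"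
    \<comment> \<open>The indicator function of the neutral element represents \<open>1\<close> in the group ring.\<close>
    define \<delta> where "\<delta> = (\<lambda>c\<in>carrier F. if c = \<one>\<^bsub>F\<^esub> then \<one>\<^bsub>L\<^esub> else \<zero>\<^bsub>L\<^esub>)"
    have \<delta>: "\<delta> \<in> carrier M" by (auto simp: \<delta>_def fun_ring_simps)
    have \<delta>1: "leads \<delta> \<one>\<^bsub>ELT\<^esub>"
      using leq_linear(1) by (auto simp: elt_ring_def adjoin_simps \<delta>_def)
    have "eval_poly E (\<lambda>t. \<ominus>\<^bsub>E\<^esub> t) (\<lambda>i. translate (r i)) P
        = eval_poly E (\<lambda>t. \<ominus>\<^bsub>E\<^esub> t) (\<lambda>i. translate (r i)) Q" (is "?p = ?q")
      by (rule E.identity_at_commuting_elements[OF comm_rings])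
        (rule translate_closed[OF r], rule translate_commute[OF r r])
    moreover have "leads (?p \<delta>) ?P" "leads (?q \<delta>) ?Q"
      by (rule leads_eval_poly[OF r \<delta> \<delta>1])+
    ultimately have "leads (?p \<delta>) ?P" "leads (?p \<delta>) ?Q" by simp_all
    moreover have "map_option snd (r i) \<in> carrier (max_plus F leq)" for i
      using r[of i] by (auto simp: ELT_carrier max_plus_def adjoin_simps)
    then have "map_option snd ?P = map_option snd ?Q"
      using tropical_identity_transfer[OF tropical, of "map_option snd \<circ> r"]
      by (simp add: value_eval_poly[OF r])
    ultimately have "?P = ?Q" by (rule leads_unique)
    moreover have "eval_poly ELT (elt_neg L F leq) s P = ?P" "eval_poly ELT (elt_neg L F leq) s Q = ?Q"
      using assms(1,2) by (auto intro!: eval_poly_cong simp: r_def)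
    ultimately show "eval_poly ELT (elt_neg L F leq) s P = eval_poly ELT (elt_neg L F leq) s Q"
      by simp
  qed
qed

end
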